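(* Let $F=H+\overline{G}\in\mathcal{H}$, with $H(z)=z+\sum_{n=2}^\infty A_nz^n$, $G(z)=\sum_{n=1}^\infty B_nz^n$, satisfy $G'(0)=B_1=0$ and $$\sum_{n=2}^\infty n(2n-1)(|A_n|+|B_n|)\le1.$$ Let $a\ge1$ be real and define $$h_a(z)=\frac{aH(z)+zH'(z)}{a+1},\qquad g_a(z)=\frac{aG(z)+zG'(z)}{a+1}.$$ Then the harmonic function $f_a=h_a+\overline{g_a}$ belongs to $\mathcal{US}^*_H$.
   Context: $\mathbb{D}=\{z\in\mathbb{C}:|z|<1\}$. $\mathcal{H}$ is the class of complex-valued harmonic functions $f=h+\overline{g}$ in $\mathbb{D}$, with $h,g$ analytic in $\mathbb{D}$ and $h(z)=z+\sum_{n\ge2}a_nz^n$, $g(z)=\sum_{n\ge1}b_nz^n$. $\mathcal{S}_H$ is the class of $f\in\mathcal{H}$ that are univalent and sense-preserving ($J_f=|h'|^2-|g'|^2>0$) in $\mathbb{D}$. A function $f\in C^1(\mathbb{D})$ is uniformly starlike in $\mathbb{D}$ if $f$ is fully starlike in $\mathbb{D}$ (each circle $|z|=r$, $0<r<1$, is mapped one-to-one onto a curve bounding a domain starlike with respect to the origin) and $f$ maps every circular arc $\gamma_\zeta$ contained in $\mathbb{D}$ with center $\zeta\in\mathbb{D}$ to an arc $f(\gamma_\zeta)$ which is starlike with respect to $f(\zeta)$ (i.e. $\arg(f(z)-f(\zeta))$ is nondecreasing as $z$ traverses $\gamma_\zeta$ positively). $\mathcal{US}^*_H$ is the class of all $f\in\mathcal{S}_H$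 that are uniformly starlike in $\mathbb{D}$. *)

theory Defs
  imports "HOL-Complex_Analysis.Complex_Analysis"
begin

abbreviation unit_disk :: "complex set" where
  "unit_disk \<equiv> ball 0 1"

text \<open>
  \<open>f = h + cnj g\<close> on the unit disk with
  \<open>h z = z + (\<Sum>n\<ge>2. a n * z ^ n)\<close> and \<open>g z = (\<Sum>n\<ge>1. b n * z ^ n)\<close>.
  The values \<open>a 0\<close>, \<open>a 1\<close>, \<open>b 0\<close> play no role. Functions are total in HOL; only their
  values on the unit disk matter here and below.
\<close>

definition harmonic_rep ::
  "(complex \<Rightarrow> complex) \<Rightarrow> (complex \<Rightarrow> complex) \<Rightarrow> (complex \<Rightarrow> complex)
     \<Rightarrow> (nat \<Rightarrow> complex) \<Rightarrow> (nat \<Rightarrow> complex) \<Rightarrow> bool" where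
  "harmonic_rep f h g a b \<longleftrightarrow>
     h holomorphic_on unit_disk \<and> g holomorphic_on unit_disk \<and>
     (\<forall>z\<in>unit_disk. (\<lambda>n. a (n + 2) * z ^ (n + 2)) sums (h z - z)) \<and>
     (\<forall>z\<in>unit_disk. (\<lambda>n. b (n + 1) * z ^ (n + 1)) sums g z) \<and>
     (\<forall>z\<in>unit_disk. f z = h z + cnj (g z))"

definition class_H :: "(complex \<Rightarrow> complex) set" where
  "class_H = {f. \<exists>h g a b. harmonic_rep f h g a b}"

text \<open>
  The normalisation \<open>g 0 = 0\<close> makes \<open>h\<close> and \<open>g\<close> unique on the disk, so the existential
  quantifier below only names the two parts of \<open>f\<close>.
\<close>

definition sense_preserving :: "(complex \<Rightarrow> complex) \<Rightarrow> bool" where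
  "sense_preserving f \<longleftrightarrow>
     (\<exists>h g a b. harmonic_rep f h g a b \<and>
        (\<forall>z\<in>unit_disk. (cmod (deriv h z))\<^sup>2 - (cmod (deriv g z))\<^sup>2 > 0))"

definition class_S_H :: "(complex \<Rightarrow> complex) set" where
  "class_S_H = {f \<in> class_H. inj_on f unit_disk \<and> sense_preserving f}"

text \<open>Continuous differentiability in the real sense.\<close>

definition C1_on :: "complex set \<Rightarrow> (complex \<Rightarrow> complex) \<Rightarrow> bool" where
  "C1_on S f \<longleftrightarrow>
     (\<exists>f' :: complex \<Rightarrow> complex \<Rightarrow>\<^sub>L complex.
        (\<forall>z\<in>S. (f has_derivative blinfun_apply (f' z)) (at z)) \<and> continuous_on S f')"

definition starlike_wrt :: "complex \<Rightarrow> complex set \<Rightarrow> bool" where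
  "starlike_wrt c S \<longleftrightarrow> c \<in> S \<and> (\<forall>w\<in>S. closed_segment c w \<subseteq> S)"

text \<open>
  The image of each circle is a Jordan curve, and \<open>inside\<close> of it is the domain it bounds.
\<close>

definition fully_starlike :: "(complex \<Rightarrow> complex) \<Rightarrow> bool" where
  "fully_starlike f \<longleftrightarrow>
     (\<forall>r. 0 < r \<and> r < 1 \<longrightarrow>
        continuous_on (sphere 0 r) f \<and> inj_on f (sphere 0 r) \<and>
        starlike_wrt 0 (inside (f ` sphere 0 r)))"

text \<open>
  The path \<open>\<gamma>\<close>, parametrised over \<open>[s, t]\<close>, avoids \<open>c\<close>, and \<open>\<theta>\<close> is a continuous branch of
  \<open>arg (\<gamma> u - c)\<close> that is nondecreasing in \<open>u\<close>.
\<close>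

definition starlike_arc :: "complex \<Rightarrow> (real \<Rightarrow> complex) \<Rightarrow> real \<Rightarrow> real \<Rightarrow> bool" where
  "starlike_arc c \<gamma> s t \<longleftrightarrow>
     (\<exists>\<theta>. continuous_on {s..t} \<theta> \<and> mono_on {s..t} \<theta> \<and>
        (\<forall>u\<in>{s..t}. \<gamma> u \<noteq> c \<and> \<gamma> u - c = rcis (cmod (\<gamma> u - c)) (\<theta> u)))"

text \<open>
  The arcs centred at \<open>\<zeta>\<close> are \<open>u \<mapsto> \<zeta> + rcis r u\<close> for \<open>u\<close> in \<open>[s, t]\<close>, traversed in the
  positive direction, up to and including full circles. Only the arc has to lie in the disk,
  not the whole circle that carries it.
\<close>

definition uniformly_starlike :: "(complex \<Rightarrow> complex) \<Rightarrow> bool" where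
  "uniformly_starlike f \<longleftrightarrow>
     C1_on unit_disk f \<and> fully_starlike f \<and>
     (\<forall>\<zeta>\<in>unit_disk. \<forall>r s t.
        0 < r \<and> s < t \<and> t \<le> s + 2 * pi \<and> (\<lambda>u. \<zeta> + rcis r u) ` {s..t} \<subseteq> unit_disk \<longrightarrow>
        starlike_arc (f \<zeta>) (\<lambda>u. f (\<zeta> + rcis r u)) s t)"

definition class_US_H :: "(complex \<Rightarrow> complex) set" where
  "class_US_H = {f \<in> class_S_H. uniformly_starlike f}"

end

theory Submission
  imports Defs
begin

text \<open>
  The averaging multiplies the \<open>n\<close>-th coefficients by \<open>(a + n) / (a + 1)\<close>, which is at most \<open>n\<close>
  (\<open>averaging_factor_le\<close>). The hypothesis therefore yields
  \<open>\<Sum>n\<ge>2. (2 n - 1) (\<bar>a\<^sub>n\<bar> + \<bar>b\<^sub>n\<bar>) \<le> 1\<close> for the coefficients of \<open>f = h + cnj g\<close>, and this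
  condition alone makes \<open>f\<close> uniformly starlike.

  On a circular arc \<open>z = \<zeta> + r e\<^sup>i\<^sup>u\<close> the derivative of \<open>f\<close> in \<open>u\<close> is \<open>\<i> N\<close> with
  \<open>N = (z - \<zeta>) h' z - cnj ((z - \<zeta>) g' z)\<close>. Writing \<open>D = f z - f \<zeta>\<close>, the argument of \<open>D\<close> is
  nondecreasing in \<open>u\<close> as soon as \<open>Re (N * cnj D) \<ge> 0\<close>, that is, as soon as
  \<open>norm (N - D) \<le> norm (N + D)\<close>. Expanding both sides in power series, the term \<open>z\<close> of \<open>f\<close>
  contributes \<open>2 \<bar>z - \<zeta>\<bar>\<close> to the right-hand side and nothing to the left-hand side, while the
  coefficients of index \<open>n\<close> cost at most \<open>(4 n - 2) (\<bar>a\<^sub>n\<bar> + \<bar>b\<^sub>n\<bar>) \<bar>z - \<zeta>\<bar>\<close> in total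
  (\<open>norm_tangent_chord_le\<close>, \<open>rotation\<close>). The same weights bound \<open>\<bar>D\<bar>\<close> from below by
  \<open>\<bar>z - \<zeta>\<bar> / 3\<close> and keep \<open>\<bar>g'\<bar>\<close> below \<open>\<bar>h'\<bar>\<close>, so that \<open>f\<close> is univalent and sense-preserving.

  The domain bounded by the image of the circle \<open>\<bar>z\<bar> = r\<close> is the image of the disk \<open>\<bar>z\<bar> < r\<close>
  (\<open>inside_image_sphere\<close>). It is starlike because the inequality for \<open>\<zeta> = 0\<close> has a second
  reading: it says that the preimage of \<open>t * f z\<close> moves away from the origin as \<open>t\<close> grows, so the
  preimage of the segment from 0 to \<open>f z\<close> never leaves the disk of radius \<open>\<bar>z\<bar>\<close>
  (\<open>segment_to_image_point\<close>).
\<close>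

section \<open>Estimates for a power series without constant and linear term\<close>

text \<open>
  One power of \<open>z\<close> is split off, \<open>z\<^sup>n - w\<^sup>n = (z - w) z\<^sup>n\<^sup>-\<^sup>1 + w (z\<^sup>n\<^sup>-\<^sup>1 - w\<^sup>n\<^sup>-\<^sup>1)\<close>; it cancels one of the
  \<open>n\<close> copies of \<open>(z - w) z\<^sup>n\<^sup>-\<^sup>1\<close>, which is why the factor is \<open>2 (n - 1)\<close> and not \<open>2 n\<close>.
\<close>

lemma norm_power_tangent_minus_chord_le:
  fixes z w :: complex
  assumes "norm z \<le> 1" "norm w \<le> 1" "1 \<le> n"
  shows "norm ((z - w) * (of_nat n * z ^ (n - 1)) - (z ^ n - w ^ n)) \<le> 2 * (real n - 1) * norm (z - w)"
proof -
  obtain m where n: "n = Suc m"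
    using assms(3) by (cases n) auto
  have "(z - w) * (of_nat n * z ^ (n - 1)) - (z ^ n - w ^ n)
      = of_nat m * ((z - w) * z ^ m) - w * (z ^ m - w ^ m)"
    by (simp add: n algebra_simps)
  also have "norm \<dots> \<le> norm (of_nat m * ((z - w) * z ^ m)) + norm (w * (z ^ m - w ^ m))"
    by (rule norm_triangle_ineq4)
  also have "norm (of_nat m * ((z - w) * z ^ m)) \<le> real m * (norm (z - w) * 1)"
    unfolding norm_mult norm_power norm_of_nat
    using assms by (intro mult_left_mono power_le_one) auto
  also have "norm (w * (z ^ m - w ^ m)) \<le> 1 * (real m * norm (z - w))"
    unfolding norm_mult using assms by (intro mult_mono norm_power_diff) auto
  finally show ?thesis
    by (simp add: n)
qed

lemma norm_power_tangent_plus_chord_le: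
  fixes z w :: complex
  assumes "norm z \<le> 1" "norm w \<le> 1"
  shows "norm ((z - w) * (of_nat n * z ^ (n - 1)) + (z ^ n - w ^ n)) \<le> 2 * real n * norm (z - w)"
proof -
  have "norm ((z - w) * (of_nat n * z ^ (n - 1)) + (z ^ n - w ^ n))
      \<le> norm ((z - w) * (of_nat n * z ^ (n - 1))) + norm (z ^ n - w ^ n)"
    by (rule norm_triangle_ineq)
  also have "norm ((z - w) * (of_nat n * z ^ (n - 1))) \<le> norm (z - w) * (real n * 1)"
    unfolding norm_mult norm_power norm_of_nat
    using assms by (intro mult_left_mono power_le_one) auto
  also have "norm (z ^ n - w ^ n) \<le> real n * norm (z - w)"
    using assms by (rule norm_power_diff)
  finally show ?thesis
    by simp
qed

lemma deriv_power_series_sums: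
  fixes k :: "complex \<Rightarrow> complex"
  assumes "\<And>z. norm z < 1 \<Longrightarrow> (\<lambda>n. c n * z ^ n) sums k z" "norm z < 1"
    and "(k has_field_derivative k') (at z)"
  shows "(\<lambda>n. of_nat n * c n * z ^ (n - 1)) sums k'"
proof -
  have "(\<lambda>n. diffs c n * z ^ n) sums k'"
    by (rule termdiffs_sums_strong) (use assms in auto)
  then have "(\<lambda>n. of_nat (Suc n) * c (Suc n) * z ^ (Suc n - 1)) sums k'"
    by (simp add: diffs_def)
  then show ?thesis
    using sums_Suc_iff[of "\<lambda>n. of_nat n * c n * z ^ (n - 1)" k'] by simp
qed

locale weighted_power_series =
  fixes c :: "nat \<Rightarrow> complex" and k :: "complex \<Rightarrow> complex" and W :: real
  assumes series: "norm z < 1 \<Longrightarrow> (\<lambda>n. c n * z ^ n) sums k z"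
    and low: "c 0 = 0" "c (Suc 0) = 0"
    and weight: "(\<lambda>n. (2 * real n - 1) * cmod (c n)) sums W"
begin

lemma holomorphic: "k holomorphic_on unit_disk"
  by (rule power_series_holomorphic[where a = c]) (use series in auto)

lemma has_field_derivative: "norm z < 1 \<Longrightarrow> (k has_field_derivative deriv k z) (at z)"
  using holomorphic by (simp add: holomorphic_derivI)

lemma derivative_sums: "norm z < 1 \<Longrightarrow> (\<lambda>n. of_nat n * c n * z ^ (n - 1)) sums deriv k z"
  by (rule deriv_power_series_sums[OF series _ has_field_derivative])

text \<open>
  As the series starts at \<open>n = 2\<close>, where \<open>2 / 3 * (2 * n - 1) = n\<close>, the weight \<open>2 n - 1\<close> controls
  the weight \<open>n\<close> that governs first derivatives, with room to spare.
\<close>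

lemma coefficient_weight_le: "real n * cmod (c n) \<le> 2 / 3 * ((2 * real n - 1) * cmod (c n))"
proof (cases "n \<le> 1")
  case True
  then show ?thesis
    using low by (cases n) auto
next
  case False
  then have "real n \<le> 2 / 3 * (2 * real n - 1)"
    by auto
  then have "real n * cmod (c n) \<le> 2 / 3 * (2 * real n - 1) * cmod (c n)"
    by (intro mult_right_mono) auto
  then show ?thesis
    by (simp only: mult.assoc)
qed

lemma norm_deriv_le:
  assumes "norm z < 1"
  shows "norm (deriv k z) \<le> 2 / 3 * W"
proof (rule norm_sums_le[OF derivative_sums sums_mult[OF weight]])
  fix n
  have "norm (of_nat n * c n * z ^ (n - 1)) \<le> real n * cmod (c n)"
    using assms by (simp add: norm_mult norm_power mult_left_le power_le_one)
  then show "norm (of_nat n * c n * z ^ (n - 1)) \<le> 2 / 3 * ((2 * real n - 1) * cmod (c n))"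
    using coefficient_weight_le[of n] by linarith
qed (use assms in auto)

lemma norm_chord_le:
  assumes "norm z < 1" "norm w < 1"
  shows "norm (k z - k w) \<le> 2 / 3 * W * norm (z - w)"
proof -
  have s: "(\<lambda>n. c n * z ^ n - c n * w ^ n) sums (k z - k w)"
    by (intro sums_diff series assms)
  have "norm (k z - k w) \<le> norm (z - w) * (2 / 3 * W)"
  proof (rule norm_sums_le[OF s sums_mult[OF sums_mult[OF weight]]])
    fix n
    have "norm (c n * z ^ n - c n * w ^ n) = cmod (c n) * norm (z ^ n - w ^ n)"
      by (simp add: right_diff_distrib[symmetric] norm_mult)
    also have "\<dots> \<le> cmod (c n) * (real n * norm (z - w))"
      using assms by (intro mult_left_mono norm_power_diff) auto
    also have "\<dots> = norm (z - w) * (real n * cmod (c n))"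
      by (simp add: mult_ac)
    also have "\<dots> \<le> norm (z - w) * (2 / 3 * ((2 * real n - 1) * cmod (c n)))"
      by (intro mult_left_mono coefficient_weight_le) auto
    finally show "norm (c n * z ^ n - c n * w ^ n)
        \<le> norm (z - w) * (2 / 3 * ((2 * real n - 1) * cmod (c n)))" .
  qed
  then show ?thesis
    by (simp add: mult_ac)
qed

text \<open>
  The two bounds are summed because only their total matters later, and the coefficientwise total
  \<open>2 (n - 1) + 2 n = 2 (2 n - 1)\<close> is exactly twice the weight.
\<close>

lemma norm_tangent_chord_le:
  assumes z: "norm z < 1" and w: "norm w < 1"
  shows "norm ((z - w) * deriv k z - (k z - k w)) + norm ((z - w) * deriv k z + (k z - k w))
      \<le> 2 * W * norm (z - w)"
proof -
  define d where "d n = (z - w) * (of_nat n * c n * z ^ (n - 1))" for n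
  define e where "e n = c n * z ^ n - c n * w ^ n" for n
  have d: "d sums ((z - w) * deriv k z)"
    unfolding d_def by (intro sums_mult derivative_sums z)
  have e: "e sums (k z - k w)"
    unfolding e_def by (intro sums_diff series z w)
  have termle: "norm (d n - e n) + norm (d n + e n)
      \<le> norm (z - w) * (2 * ((2 * real n - 1) * cmod (c n)))" for n
  proof (cases "n = 0")
    case True
    then show ?thesis
      by (simp add: d_def e_def low)
  next
    case False
    have "d n - e n = c n * ((z - w) * (of_nat n * z ^ (n - 1)) - (z ^ n - w ^ n))"
      "d n + e n = c n * ((z - w) * (of_nat n * z ^ (n - 1)) + (z ^ n - w ^ n))"
      by (simp_all add: d_def e_def algebra_simps)
    then have "norm (d n - e n) + norm (d n + e n)
        \<le> cmod (c n) * (2 * (real n - 1) * norm (z - w)) + cmod (c n) * (2 * real n * norm (z - w))"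
      unfolding norm_mult using z w False
      by (simp only: norm_mult)
        (intro add_mono mult_left_mono norm_power_tangent_minus_chord_le
          norm_power_tangent_plus_chord_le; simp)
    then show ?thesis
      by (simp add: algebra_simps)
  qed
  have T: "summable (\<lambda>n. norm (z - w) * (2 * ((2 * real n - 1) * cmod (c n))))"
    by (intro summable_mult sums_summable[OF weight])
  have sm: "summable (\<lambda>n. norm (d n - e n))"
    by (rule summable_comparison_test'[OF T, of 0])
      (use termle in \<open>smt (verit) norm_ge_zero real_norm_def\<close>)
  have sp: "summable (\<lambda>n. norm (d n + e n))"
    by (rule summable_comparison_test'[OF T, of 0])
      (use termle in \<open>smt (verit) norm_ge_zero real_norm_def\<close>)
  have "norm ((z - w) * deriv k z - (k z - k w)) \<le> (\<Sum>n. norm (d n - e n))"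
    by (rule norm_sums_le[OF sums_diff[OF d e] summable_sums[OF sm]]) simp
  moreover have "norm ((z - w) * deriv k z + (k z - k w)) \<le> (\<Sum>n. norm (d n + e n))"
    by (rule norm_sums_le[OF sums_add[OF d e] summable_sums[OF sp]]) simp
  moreover have "(\<Sum>n. norm (d n - e n)) + (\<Sum>n. norm (d n + e n)) \<le> norm (z - w) * (2 * W)"
    by (rule sums_le[OF termle sums_add[OF summable_sums[OF sm] summable_sums[OF sp]]
        sums_mult[OF sums_mult[OF weight]]])
  ultimately show ?thesis
    by (simp add: mult_ac)
qed

end

section \<open>Arcs, circles and starlike images\<close>

text \<open>
  The branch of the argument is obtained by integrating the logarithmic derivative:
  \<open>\<theta> = Im L\<close> with \<open>L u = Ln (p s) + \<integral>\<^sub>s\<^sup>u p' / p\<close>. Then \<open>p = exp \<circ> L\<close>, because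
  \<open>exp (- L) * p\<close> has derivative zero and value one at \<open>s\<close>.
\<close>

lemma starlike_arcI:
  fixes \<gamma> p' :: "real \<Rightarrow> complex"
  assumes st: "s \<le> t"
    and der: "\<And>u. u \<in> {s..t} \<Longrightarrow> (\<gamma> has_vector_derivative p' u) (at u within {s..t})"
    and cont: "continuous_on {s..t} p'"
    and nz: "\<And>u. u \<in> {s..t} \<Longrightarrow> \<gamma> u \<noteq> c"
    and rot: "\<And>u. u \<in> {s..t} \<Longrightarrow> 0 \<le> Im (p' u / (\<gamma> u - c))"
  shows "starlike_arc c \<gamma> s t"
proof -
  define p where "p u = \<gamma> u - c" for u
  define q where "q u = p' u / p u" for u
  define L where "L u = Ln (p s) + integral {s..u} q" for u
  have pder: "(p has_vector_derivative p' u) (at u within {s..t})" if "u \<in> {s..t}" for u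
    unfolding p_def using has_vector_derivative_diff[OF der[OF that] has_vector_derivative_const[of c]]
    by simp
  have pcont: "continuous_on {s..t} p"
    using pder by (meson continuous_on_eq_continuous_within has_vector_derivative_continuous)
  have pnz: "p u \<noteq> 0" if "u \<in> {s..t}" for u
    using nz[OF that] by (simp add: p_def)
  have qcont: "continuous_on {s..t} q"
    unfolding q_def using cont pcont pnz by (intro continuous_on_divide) auto
  have Lder: "(L has_vector_derivative q u) (at u within {s..t})" if "u \<in> {s..t}" for u
    unfolding L_def
    using has_vector_derivative_add[OF has_vector_derivative_const
        integral_has_vector_derivative[OF qcont that]] by simp
  have Lcont: "continuous_on {s..t} L"
    using Lder by (meson continuous_on_eq_continuous_within has_vector_derivative_continuous)
  define E where "E u = exp (- L u)" for u
  have Eder: "(E has_vector_derivative - q u * E u) (at u within {s..t})" if "u \<in> {s..t}" for u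
    unfolding E_def
    using field_vector_diff_chain_within[OF has_vector_derivative_minus[OF Lder[OF that]],
        of exp "exp (- L u)"]
    by (simp add: o_def DERIV_exp has_field_derivative_at_within)
  have "((\<lambda>u. E u * p u) has_vector_derivative 0) (at v within {s..t})" if v: "v \<in> {s..t}" for v
  proof -
    have "((\<lambda>u. E u * p u) has_vector_derivative E v * p' v + - q v * E v * p v) (at v within {s..t})"
      by (rule has_vector_derivative_mult[OF Eder[OF v] pder[OF v]])
    moreover have "E v * p' v + - q v * E v * p v = 0"
      using pnz[OF v] by (simp add: q_def)
    ultimately show ?thesis
      by metis
  qed
  then obtain C where "E u * p u = C" if "u \<in> {s..t}" for u
    using has_vector_derivative_zero_constant[of "{s..t}" "\<lambda>u. E u * p u"] by force
  then have "E u * p u = E s * p s" if "u \<in> {s..t}" for u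
    using that st by simp
  moreover have "E s * p s = 1"
    using pnz[of s] st by (simp add: E_def L_def exp_minus)
  ultimately have pexp: "p u = exp (L u)" if "u \<in> {s..t}" for u
    using that by (simp add: E_def exp_minus field_simps)
  show ?thesis
    unfolding starlike_arc_def
  proof (intro exI[of _ "\<lambda>u. Im (L u)"] conjI ballI)
    show "continuous_on {s..t} (\<lambda>u. Im (L u))"
      using Lcont by (intro continuous_intros)
    show "mono_on {s..t} (\<lambda>u. Im (L u))"
    proof (rule mono_onI)
      fix u v
      assume uv: "u \<in> {s..t}" "v \<in> {s..t}" "u \<le> v"
      show "Im (L u) \<le> Im (L v)"
      proof (rule DERIV_nonneg_imp_increasing_open[of u v "\<lambda>u. Im (L u)"])
        show "u \<le> v" by fact
        show "continuous_on {u..v} (\<lambda>u. Im (L u))"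
          by (rule continuous_on_subset[of "{s..t}"])
            (use uv Lcont in \<open>auto intro!: continuous_intros\<close>)
        fix x
        assume x: "u < x" "x < v"
        have "(L has_vector_derivative q x) (at x within {s..t})"
          using Lder x uv by simp
        moreover have "at x within {s..t} = at x"
          by (rule at_within_interior) (use x uv in auto)
        ultimately have "((\<lambda>u. Im (L u)) has_vector_derivative Im (q x)) (at x)"
          using bounded_linear.has_vector_derivative[OF bounded_linear_Im] by fastforce
        then show "\<exists>y. ((\<lambda>u. Im (L u)) has_real_derivative y) (at x) \<and> 0 \<le> y"
          using rot[of x] x uv
          by (auto simp: has_real_derivative_iff_has_vector_derivative q_def p_def)
      qed
    qed
    fix u
    assume u: "u \<in> {s..t}"
    show "\<gamma> u \<noteq> c"
      using nz[OF u] .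
    show "\<gamma> u - c = rcis (cmod (\<gamma> u - c)) (Im (L u))"
      using pexp[OF u] unfolding p_def by (simp only: rcis_def norm_exp_eq_Re exp_eq_polar[symmetric])
  qed
qed

text \<open>
  The image of the open ball is open by invariance of domain, hence part of the interior of the
  image of the closed ball, whose frontier lies in the image of the sphere. Conversely the
  complement of the image of the closed ball is connected and unbounded, so nothing else is
  enclosed by the image of the sphere.
\<close>

lemma inside_image_sphere:
  fixes f :: "complex \<Rightarrow> complex"
  assumes cont: "continuous_on (cball a r) f" and inj: "inj_on f (cball a r)"
  shows "inside (f ` sphere a r) = f ` ball a r"
proof
  have cpt: "compact (f ` cball a r)"
    by (rule compact_continuous_image[OF cont compact_cball])
  have union: "f ` cball a r = f ` ball a r \<union> f ` sphere a r"
    by (force simp: le_less)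
  have disj: "f ` ball a r \<inter> f ` sphere a r = {}"
  proof -
    have "f x \<noteq> f y" if "x \<in> ball a r" "y \<in> sphere a r" for x y
      using inj_onD[OF inj, of x y] that by auto
    then show ?thesis
      by blast
  qed
  have "cball a r homeomorphic f ` cball a r"
    by (rule homeomorphic_compact[OF compact_cball cont refl inj])
  then have "connected (- f ` cball a r)"
    by (intro connected_complement_homeomorphic_convex_compact[OF homeomorphic_sym[THEN iffD1]]) auto
  moreover have "\<not> bounded (- f ` cball a r)"
    using cpt cobounded_imp_unbounded compact_imp_bounded by blast
  moreover have "f ` ball a r \<union> - f ` cball a r = - f ` sphere a r"
    using union disj by blast
  ultimately show "inside (f ` sphere a r) \<subseteq> f ` ball a r"
    by (rule inside_subset)
  have "open (f ` ball a r)"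
    by (rule invariance_of_domain)
      (use cont inj in \<open>auto intro: continuous_on_subset inj_on_subset\<close>)
  then have int: "f ` ball a r \<subseteq> interior (f ` cball a r)"
    by (intro interior_maximal) auto
  then have fr: "frontier (f ` cball a r) \<subseteq> f ` sphere a r"
  proof -
    have "frontier (f ` cball a r) = f ` cball a r - interior (f ` cball a r)"
      by (simp add: frontier_def closure_closed compact_imp_closed[OF cpt])
    then show ?thesis
      using union int by auto
  qed
  have "f ` ball a r \<subseteq> inside (frontier (f ` cball a r))"
    by (rule order_trans[OF int interior_inside_frontier[OF compact_imp_bounded[OF cpt]]])
  then show "f ` ball a r \<subseteq> inside (f ` sphere a r)"
    using inside_mono[OF fr] disj by blast
qed

text \<open>
  With \<open>w = f z\<close>, the preimage of \<open>t w\<close> has a modulus that is nondecreasing in \<open>t\<close>, since its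
  velocity is \<open>M w\<close>, that is \<open>1 / t\<close> times \<open>M\<close> applied to the value \<open>t w\<close> of \<open>f\<close> there, and by
  the assumption \<open>out\<close> this points away from the origin. As \<open>t\<close> decreases
  from 1, the preimage therefore stays in the compact disk of radius \<open>norm z\<close>; at the last
  parameter where this is so it could still be continued, so it persists down to \<open>t = 0\<close>.
\<close>

lemma segment_to_image_point:
  fixes f :: "complex \<Rightarrow> complex"
  assumes f0: "f 0 = 0" and inj: "inj_on f unit_disk"
    and der: "\<And>z. z \<in> unit_disk \<Longrightarrow> (f has_derivative L z) (at z)"
    and right_inverse: "\<And>z. z \<in> unit_disk \<Longrightarrow> L z \<circ> M z = id"
    and M: "\<And>z. z \<in> unit_disk \<Longrightarrow> linear (M z)"
    and out: "\<And>z. z \<in> unit_disk \<Longrightarrow> 0 \<le> z \<bullet> M z (f z)"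
    and z: "z \<in> unit_disk" and t0: "0 \<le> t\<^sub>0" "t\<^sub>0 \<le> 1"
  shows "of_real t\<^sub>0 * f z \<in> f ` cball 0 (norm z)"
proof (rule ccontr)
  define K where "K = f ` cball 0 (norm z)"
  assume "of_real t\<^sub>0 * f z \<notin> f ` cball 0 (norm z)"
  then have bad: "of_real t\<^sub>0 * f z \<notin> K"
    by (simp add: K_def)
  have sub: "cball 0 (norm z) \<subseteq> unit_disk"
    using z by auto
  have cont: "continuous_on unit_disk f"
    using der by (meson continuous_at_imp_continuous_on has_derivative_continuous)
  have opn: "open (f ` unit_disk)"
    by (rule invariance_of_domain[OF cont _ inj]) auto
  have "compact K"
    unfolding K_def by (intro compact_continuous_image continuous_on_subset[OF cont sub] compact_cball)
  define T where "T = {t\<^sub>0..1} \<inter> (\<lambda>t. of_real t * f z) -` K"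
  have "closed T"
    unfolding T_def using \<open>compact K\<close>
    by (intro continuous_closed_preimage continuous_intros compact_imp_closed) auto
  moreover have "1 \<in> T"
    using t0 by (simp add: T_def K_def)
  moreover have bdd: "bdd_below T"
    by (rule bdd_belowI[of _ t\<^sub>0]) (simp add: T_def)
  moreover define \<tau> where "\<tau> = Inf T"
  ultimately have tau: "\<tau> \<in> T"
    using closed_contains_Inf by blast
  have "t\<^sub>0 < \<tau>"
    using tau bad by (cases "t\<^sub>0 = \<tau>") (auto simp: T_def)
  obtain z\<^sub>1 where z1: "norm z\<^sub>1 \<le> norm z" "of_real \<tau> * f z = f z\<^sub>1"
    using tau by (auto simp: T_def K_def)
  define \<psi> where "\<psi> t = inv_into unit_disk f (of_real t * f z)" for t :: real
  have "open ((\<lambda>t::real. of_real t * f z) -` f ` unit_disk)"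
    by (intro open_vimage opn continuous_intros)
  moreover have "\<tau> \<in> (\<lambda>t. of_real t * f z) -` f ` unit_disk"
    using z1 z by auto
  ultimately obtain e where e: "e > 0" "ball \<tau> e \<subseteq> (\<lambda>t. of_real t * f z) -` f ` unit_disk"
    by (meson openE)
  \<comment> \<open>Below \<open>\<tau>\<close> but above \<open>t\<^sub>0\<close>, hence positive, and so close to \<open>\<tau>\<close> that preimages exist in between.\<close>
  define t\<^sub>1 where "t\<^sub>1 = max ((t\<^sub>0 + \<tau>) / 2) (\<tau> - e / 2)"
  have t1: "0 < t\<^sub>1" "t\<^sub>0 \<le> t\<^sub>1" "t\<^sub>1 < \<tau>"
    using e(1) \<open>t\<^sub>0 < \<tau>\<close> t0 by (auto simp: t\<^sub>1_def less_max_iff_disj le_max_iff_disj)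
  have image: "of_real t * f z \<in> f ` unit_disk" if "t\<^sub>1 \<le> t" "t \<le> \<tau>" for t
  proof -
    have "t \<in> ball \<tau> e"
      using that e(1) by (auto simp: t\<^sub>1_def dist_real_def)
    then show ?thesis
      using e(2) by auto
  qed
  have psi: "\<psi> t \<in> unit_disk" "f (\<psi> t) = of_real t * f z" if "t\<^sub>1 \<le> t" "t \<le> \<tau>" for t
    unfolding \<psi>_def by (fact inv_into_into[OF image[OF that]] f_inv_into_f[OF image[OF that]])+
  have "\<psi> t\<^sub>1 \<bullet> \<psi> t\<^sub>1 \<le> \<psi> \<tau> \<bullet> \<psi> \<tau>"
  proof (rule DERIV_nonneg_imp_nondecreasing[of _ _ "\<lambda>t. \<psi> t \<bullet> \<psi> t"])
    show "t\<^sub>1 \<le> \<tau>"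
      using t1 by simp
    fix t
    assume t: "t\<^sub>1 \<le> t" "t \<le> \<tau>"
    note psi = psi[OF t]
    define v where "v = M (\<psi> t) (f z)"
    have "(inv_into unit_disk f has_derivative M (\<psi> t)) (at (f (\<psi> t)))"
      by (rule has_derivative_inverse_strong[of unit_disk _ f _ "L (\<psi> t)"])
        (use psi(1) cont inj der right_inverse in auto)
    then have "(inv_into unit_disk f has_derivative M (\<psi> t)) (at (of_real t * f z))"
      by (simp add: psi(2))
    moreover have "((\<lambda>t. of_real t * f z) has_vector_derivative f z) (at t)"
      by (auto intro!: derivative_eq_intros)
    ultimately have "(\<psi> has_vector_derivative v) (at t)"
      using vector_derivative_diff_chain_within[of "\<lambda>t. of_real t * f z" "f z" t UNIV
          "inv_into unit_disk f" "M (\<psi> t)"]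
      by (auto simp: v_def o_def \<psi>_def[abs_def] intro: has_derivative_at_withinI)
    then have "(\<psi> has_derivative (\<lambda>x. x *\<^sub>R v)) (at t)"
      by (simp add: has_vector_derivative_def)
    from has_derivative_inner[OF this this]
    have "((\<lambda>t. \<psi> t \<bullet> \<psi> t) has_real_derivative 2 * (\<psi> t \<bullet> v)) (at t)"
      unfolding has_field_derivative_def
      by (rule has_derivative_eq_rhs) (auto simp: inner_commute)
    moreover have "0 \<le> \<psi> t \<bullet> v"
    proof -
      have "f (\<psi> t) = t *\<^sub>R f z"
        by (simp add: psi(2) scaleR_conv_of_real)
      then have "t * (\<psi> t \<bullet> v) = \<psi> t \<bullet> M (\<psi> t) (f (\<psi> t))"
        using linear_cmul[OF M[OF psi(1)]] by (simp add: v_def)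
      then have "0 \<le> t * (\<psi> t \<bullet> v)"
        using out[OF psi(1)] by simp
      then show ?thesis
        using t t1 by (simp add: zero_le_mult_iff)
    qed
    ultimately show "\<exists>y. ((\<lambda>t. \<psi> t \<bullet> \<psi> t) has_real_derivative y) (at t) \<and> 0 \<le> y"
      by fastforce
  qed
  moreover have "\<psi> \<tau> = z\<^sub>1"
    unfolding \<psi>_def z1(2) using z1(1) z inj by (intro inv_into_f_f) auto
  ultimately have "norm (\<psi> t\<^sub>1) \<le> norm z"
    using z1(1) by (simp add: norm_le[symmetric])
  moreover have "of_real t\<^sub>1 * f z = f (\<psi> t\<^sub>1)"
    using psi(2)[of t\<^sub>1] t1 by simp
  ultimately have "t\<^sub>1 \<in> T"
    using t1 tau by (auto simp: T_def K_def)
  then show False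
    using cInf_lower[OF _ bdd] t1(3) by (fastforce simp: \<tau>_def)
qed

section \<open>Harmonic perturbations of the identity\<close>

locale harmonic_perturbation =
  p: weighted_power_series \<alpha> p U + g: weighted_power_series \<beta> g V
  for \<alpha> p U \<beta> g V +
  fixes f :: "complex \<Rightarrow> complex"
  assumes f_eq: "norm z < 1 \<Longrightarrow> f z = z + p z + cnj (g z)"
    and total_weight: "U + V \<le> 1"
begin

lemma f_zero: "f 0 = 0"
proof -
  have "p 0 = 0" "g 0 = 0"
    using p.series[of 0] g.series[of 0] p.low g.low
    by (auto dest!: sums_unique simp: power_0_left if_distrib cong: if_cong)
  then show ?thesis
    by (simp add: f_eq)
qed

lemma norm_diff_ge:
  assumes "norm z < 1" "norm w < 1"
  shows "norm (z - w) / 3 \<le> norm (f z - f w)"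
proof -
  have "norm (z - w) - norm (p z - p w) - norm (g z - g w) \<le> norm (f z - f w)"
  proof -
    have "norm (z - w) = norm ((f z - f w) - (p z - p w) - cnj (g z - g w))"
      using assms by (simp add: f_eq)
    also have "\<dots> \<le> norm (f z - f w) + norm (p z - p w) + norm (cnj (g z - g w))"
      by (smt (verit) norm_triangle_ineq4)
    finally show ?thesis
      by (simp only: complex_mod_cnj)
  qed
  moreover have "norm (p z - p w) + norm (g z - g w) \<le> 2 / 3 * norm (z - w)"
  proof -
    have "norm (p z - p w) + norm (g z - g w) \<le> 2 / 3 * (U + V) * norm (z - w)"
      using p.norm_chord_le[OF assms] g.norm_chord_le[OF assms] by (simp add: algebra_simps)
    also have "\<dots> \<le> 2 / 3 * 1 * norm (z - w)"
      using total_weight by (intro mult_right_mono mult_left_mono) auto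
    finally show ?thesis
      by simp
  qed
  ultimately show ?thesis
    by simp
qed

lemma injective: "inj_on f unit_disk"
proof (rule inj_onI)
  fix z w
  assume "z \<in> unit_disk" "w \<in> unit_disk" "f z = f w"
  then show "z = w"
    using norm_diff_ge[of z w] by simp
qed

text \<open>
  Let \<open>N\<close> be the velocity factor on the left and \<open>D = f z - f w\<close>. The claim is equivalent to
  \<open>norm (N - D) \<le> norm (N + D)\<close>. In \<open>N - D\<close> the identity part of \<open>f\<close> cancels, in \<open>N + D\<close> it
  contributes \<open>2 (z - w)\<close>. The conjugate in front of \<open>g\<close> reverses a sign, so in each of the two
  differences one part of \<open>f\<close> contributes tangent minus chord and the other one tangent plus
  chord. Comparing \<open>N - D\<close> with \<open>D\<close> alone would demand the larger weight \<open>3 n\<close> of the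
  coefficients of \<open>g\<close>.
\<close>

lemma rotation:
  assumes z: "norm z < 1" and w: "norm w < 1"
  shows "0 \<le> Re (((z - w) * (1 + deriv p z) - cnj ((z - w) * deriv g z)) * cnj (f z - f w))"
proof -
  define X where "X = z - w"
  define P where "P = X * deriv p z"
  define Q where "Q = X * deriv g z"
  define dp where "dp = p z - p w"
  define dg where "dg = g z - g w"
  define N where "N = X * (1 + deriv p z) - cnj (X * deriv g z)"
  define D where "D = f z - f w"
  have D: "D = X + dp + cnj dg"
    using z w by (simp add: D_def f_eq X_def dp_def dg_def)
  have N: "N = X + P - cnj Q"
    by (simp add: N_def P_def Q_def algebra_simps)
  have "norm (N - D) \<le> norm (P - dp) + norm (Q + dg)"
  proof -
    have "N - D = (P - dp) - cnj (Q + dg)"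
      by (simp add: N D)
    then show ?thesis
      by (metis norm_triangle_ineq4 complex_mod_cnj)
  qed
  moreover have "2 * norm X \<le> norm (N + D) + norm (P + dp) + norm (Q - dg)"
  proof -
    have "2 * X = (N + D) - (P + dp) + cnj (Q - dg)"
      by (simp add: N D)
    then have "norm (2 * X) \<le> norm (N + D) + norm (P + dp) + norm (cnj (Q - dg))"
      by (smt (verit) norm_triangle_ineq norm_triangle_ineq4)
    then show ?thesis
      by (simp only: complex_mod_cnj norm_mult) simp
  qed
  moreover have "norm (P - dp) + norm (P + dp) + norm (Q - dg) + norm (Q + dg) \<le> 2 * norm X"
  proof -
    have "norm (P - dp) + norm (P + dp) + norm (Q - dg) + norm (Q + dg) \<le> 2 * (U + V) * norm X"
      using p.norm_tangent_chord_le[OF z w] g.norm_tangent_chord_le[OF z w]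
      by (simp add: P_def Q_def dp_def dg_def X_def algebra_simps)
    also have "\<dots> \<le> 2 * 1 * norm X"
      using total_weight by (intro mult_right_mono mult_left_mono) auto
    finally show ?thesis
      by simp
  qed
  ultimately have "norm (N - D) \<le> norm (N + D)"
    by linarith
  then have "(norm (N - D))\<^sup>2 \<le> (norm (N + D))\<^sup>2"
    by (intro power_mono) auto
  then have "0 \<le> Re (N * cnj D)"
    by (simp add: cmod_power2) (simp add: power2_eq_square algebra_simps)
  then show ?thesis
    by (simp add: N_def D_def X_def)
qed

lemma jacobian_pos:
  assumes "norm z < 1"
  shows "0 < (cmod (1 + deriv p z))\<^sup>2 - (cmod (deriv g z))\<^sup>2"
proof -
  have "1 - norm (deriv p z) \<le> cmod (1 + deriv p z)"
    using norm_diff_ineq[of 1 "deriv p z"] by simp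
  then have "cmod (deriv g z) < cmod (1 + deriv p z)"
    using p.norm_deriv_le[OF assms] g.norm_deriv_le[OF assms] total_weight by linarith
  then show ?thesis
    by (simp add: power_strict_mono)
qed

definition real_derivative :: "complex \<Rightarrow> complex \<Rightarrow> complex" where
  "real_derivative z v = (1 + deriv p z) * v + cnj (deriv g z * v)"

lemma has_derivative_f:
  assumes "z \<in> unit_disk"
  shows "(f has_derivative real_derivative z) (at z)"
proof -
  have z: "norm z < 1"
    using assms by simp
  have "(p has_derivative (*) (deriv p z)) (at z)" "(g has_derivative (*) (deriv g z)) (at z)"
    using p.has_field_derivative[OF z] g.has_field_derivative[OF z]
    by (simp_all add: has_field_derivative_def)
  then have "((\<lambda>z. z + p z + cnj (g z)) has_derivative real_derivative z) (at z)"
    unfolding real_derivative_def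
    by (auto intro!: derivative_eq_intros simp: algebra_simps)
  then show ?thesis
    by (rule has_derivative_transform_within_open[where s = unit_disk])
      (use assms f_eq in auto)
qed

lemma continuous_f: "continuous_on unit_disk f"
  using has_derivative_f by (meson continuous_at_imp_continuous_on has_derivative_continuous)

lemma C1_on_f: "C1_on unit_disk f"
proof -
  define D where "D z = blinfun_mult_right (1 + deriv p z)
      + (Blinfun cnj o\<^sub>L blinfun_mult_right (deriv g z))" for z
  have apply_D: "blinfun_apply (D z) = real_derivative z" for z
    by (rule ext) (simp add: D_def real_derivative_def blinfun.add_left
        bounded_linear_Blinfun_apply[OF bounded_linear_cnj])
  have "continuous_on unit_disk (deriv p)" "continuous_on unit_disk (deriv g)"
    by (intro holomorphic_on_imp_continuous_on holomorphic_deriv p.holomorphic g.holomorphic; simp)+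
  then have "continuous_on unit_disk D"
    unfolding D_def
    by (intro continuous_intros bounded_linear.continuous_on[OF bounded_linear_blinfun_mult_right]
        bounded_bilinear.continuous_on[OF bounded_bilinear_blinfun_compose])
  then show ?thesis
    unfolding C1_on_def using has_derivative_f apply_D by metis
qed

text \<open>
  The inverse of the real derivative is given by Cramer's rule. The velocity of the preimage of
  \<open>t * f z\<close> at \<open>t = 1\<close> then has radial part a positive multiple of the quantity in
  \<open>rotation\<close> for \<open>w = 0\<close>.
\<close>

lemma segment_in_image:
  assumes z: "z \<in> unit_disk" and t: "0 \<le> t" "t \<le> 1"
  shows "of_real t * f z \<in> f ` cball 0 (norm z)"
proof -
  define J where "J z = (cmod (1 + deriv p z))\<^sup>2 - (cmod (deriv g z))\<^sup>2" for z
  define M where "M z v = of_real (1 / J z) * (cnj (1 + deriv p z) * v - cnj (deriv g z * v))"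
    for z v
  have "real_derivative z \<circ> M z = id" if "z \<in> unit_disk" for z
  proof
    fix v
    define c where "c = 1 + deriv p z"
    define d where "d = deriv g z"
    have "J z \<noteq> 0"
      unfolding J_def using jacobian_pos[of z] that by (metis less_irrefl mem_ball_0)
    have "(real_derivative z \<circ> M z) v = of_real (1 / J z) * ((c * cnj c - d * cnj d) * v)"
      unfolding o_def real_derivative_def M_def c_def[symmetric] d_def[symmetric]
      by (simp add: algebra_simps)
    also have "c * cnj c - d * cnj d = of_real (J z)"
      by (simp add: J_def c_def d_def complex_norm_square[symmetric] del: complex_cnj_add)
    finally show "(real_derivative z \<circ> M z) v = id v"
      using \<open>J z \<noteq> 0\<close> by simp
  qed
  moreover have "linear (M z)" for z
    by (rule linearI) (simp_all add: M_def scaleR_conv_of_real algebra_simps)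
  moreover have "0 \<le> z \<bullet> M z (f z)" if "z \<in> unit_disk" for z
  proof -
    have "z \<bullet> M z (f z) = 1 / J z * Re ((z * (1 + deriv p z) - cnj (z * deriv g z)) * cnj (f z))"
    proof -
      have "z \<bullet> M z (f z)
          = 1 / J z * (z \<bullet> (cnj (1 + deriv p z) * f z - cnj (deriv g z * f z)))"
        unfolding M_def scaleR_conv_of_real[symmetric] by (rule inner_scaleR_right)
      also have "z \<bullet> (cnj (1 + deriv p z) * f z - cnj (deriv g z * f z))
          = Re ((z * (1 + deriv p z) - cnj (z * deriv g z)) * cnj (f z))"
        by (simp add: inner_complex_def algebra_simps)
      finally show ?thesis .
    qed
    moreover have "0 \<le> Re ((z * (1 + deriv p z) - cnj (z * deriv g z)) * cnj (f z))"
      using rotation[of z 0] that by (simp only: f_zero diff_zero mem_ball_0 norm_zero zero_less_one)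
    moreover have "0 < J z"
      unfolding J_def using jacobian_pos[of z] that by (simp only: mem_ball_0)
    ultimately show ?thesis
      by (simp only: mult_nonneg_nonneg divide_nonneg_pos zero_le_one)
  qed
  ultimately show ?thesis
    using segment_to_image_point[OF f_zero injective has_derivative_f, of M] z t by blast
qed

lemma fully_starlike_f: "fully_starlike f"
  unfolding fully_starlike_def
proof (intro allI impI conjI)
  fix r :: real
  assume r: "0 < r \<and> r < 1"
  then have sub: "cball 0 r \<subseteq> unit_disk" "sphere 0 r \<subseteq> unit_disk"
    by auto
  show "continuous_on (sphere 0 r) f" "inj_on f (sphere 0 r)"
    using sub continuous_on_subset[OF continuous_f] inj_on_subset[OF injective] by auto
  have "inside (f ` sphere 0 r) = f ` ball 0 r"
    using sub continuous_on_subset[OF continuous_f] inj_on_subset[OF injective]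
    by (intro inside_image_sphere) auto
  moreover have "starlike_wrt 0 (f ` ball 0 r)"
    unfolding starlike_wrt_def
  proof (intro conjI ballI subsetI)
    show "0 \<in> f ` ball 0 r"
      using r f_zero by (metis centre_in_ball image_eqI)
    fix w y
    assume "w \<in> f ` ball 0 r" and y: "y \<in> closed_segment 0 w"
    then obtain z where z: "norm z < r" "w = f z"
      by auto
    obtain t where "0 \<le> t" "t \<le> 1" "y = of_real t * f z"
      using y by (auto simp: in_segment z(2) scaleR_conv_of_real)
    then have "y \<in> f ` cball 0 (norm z)"
      using segment_in_image z r by auto
    then show "y \<in> f ` ball 0 r"
      using z by auto
  qed
  ultimately show "starlike_wrt 0 (inside (f ` sphere 0 r))"
    by simp
qed

lemma starlike_arc_f:
  assumes "\<zeta> \<in> unit_disk" "0 < r" "s < t"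
    and arc: "(\<lambda>u. \<zeta> + rcis r u) ` {s..t} \<subseteq> unit_disk"
  shows "starlike_arc (f \<zeta>) (\<lambda>u. f (\<zeta> + rcis r u)) s t"
proof -
  define \<kappa> where "\<kappa> u = \<zeta> + rcis r u" for u
  have kappa: "\<kappa> u \<in> unit_disk" if "u \<in> {s..t}" for u
    using arc that by (force simp: \<kappa>_def)
  have kder: "(\<kappa> has_vector_derivative \<i> * (\<kappa> u - \<zeta>)) (at u within {s..t})" for u
  proof -
    have "((\<lambda>u. \<zeta> + of_real r * cis u) has_vector_derivative of_real r * (\<i> * cis u))
        (at u within {s..t})"
      unfolding has_vector_derivative_def by (auto intro!: derivative_eq_intros)
    then show ?thesis
      by (simp add: \<kappa>_def[abs_def] rcis_def mult_ac)
  qed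
  have kcont: "continuous_on {s..t} \<kappa>"
    using kder by (meson continuous_on_eq_continuous_within has_vector_derivative_continuous)
  have dcont: "continuous_on {s..t} (\<lambda>u. deriv p (\<kappa> u))" "continuous_on {s..t} (\<lambda>u. deriv g (\<kappa> u))"
    by (rule continuous_on_compose2[OF _ kcont, of unit_disk];
        use kappa in \<open>auto intro!: holomorphic_on_imp_continuous_on holomorphic_deriv
          p.holomorphic g.holomorphic\<close>)+
  show ?thesis
    unfolding \<kappa>_def[symmetric]
  proof (rule starlike_arcI[where p' = "\<lambda>u. real_derivative (\<kappa> u) (\<i> * (\<kappa> u - \<zeta>))"])
    show "s \<le> t"
      using assms by simp
    show "continuous_on {s..t} (\<lambda>u. real_derivative (\<kappa> u) (\<i> * (\<kappa> u - \<zeta>)))"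
      unfolding real_derivative_def by (intro continuous_intros kcont dcont)
    fix u
    assume u: "u \<in> {s..t}"
    have norms: "norm (\<kappa> u) < 1" "norm \<zeta> < 1"
      using kappa[OF u] assms(1) by auto
    show "((\<lambda>u. f (\<kappa> u)) has_vector_derivative real_derivative (\<kappa> u) (\<i> * (\<kappa> u - \<zeta>)))
        (at u within {s..t})"
      using vector_derivative_diff_chain_within[OF kder
          has_derivative_at_withinI[OF has_derivative_f[OF kappa[OF u]]]]
      by (simp add: o_def)
    have "\<kappa> u \<noteq> \<zeta>"
      using assms(2) by (simp add: \<kappa>_def)
    then show "f (\<kappa> u) \<noteq> f \<zeta>"
      using injective kappa[OF u] assms(1) by (meson inj_onD)
    define N where "N = (\<kappa> u - \<zeta>) * (1 + deriv p (\<kappa> u)) - cnj ((\<kappa> u - \<zeta>) * deriv g (\<kappa> u))"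
    have "real_derivative (\<kappa> u) (\<i> * (\<kappa> u - \<zeta>)) = \<i> * N"
      by (simp add: real_derivative_def N_def algebra_simps)
    then have "Im (real_derivative (\<kappa> u) (\<i> * (\<kappa> u - \<zeta>)) / (f (\<kappa> u) - f \<zeta>))
        = Re (N / (f (\<kappa> u) - f \<zeta>))"
      by (metis Im_i_times times_divide_eq_right)
    also have "\<dots> = Re (N * cnj (f (\<kappa> u) - f \<zeta>)) / (cmod (f (\<kappa> u) - f \<zeta>))\<^sup>2"
      by (metis complex_div_cnj Re_divide_of_real of_real_power)
    also have "\<dots> \<ge> 0"
      unfolding N_def by (intro divide_nonneg_nonneg rotation norms) auto
    finally show "0 \<le> Im (real_derivative (\<kappa> u) (\<i> * (\<kappa> u - \<zeta>)) / (f (\<kappa> u) - f \<zeta>))" .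
  qed
qed

lemma harmonic_rep_f: "harmonic_rep f (\<lambda>z. z + p z) g \<alpha> \<beta>"
  unfolding harmonic_rep_def
proof (intro conjI ballI)
  fix z
  assume "z \<in> unit_disk"
  then have z: "norm z < 1"
    by simp
  have "(\<lambda>n. \<alpha> (n + 2) * z ^ (n + 2)) sums p z"
    using p.series[OF z] p.low
    by (subst sums_zero_iff_shift) (auto simp: less_Suc_eq numeral_2_eq_2)
  then show "(\<lambda>n. \<alpha> (n + 2) * z ^ (n + 2)) sums (z + p z - z)"
    by simp
  show "(\<lambda>n. \<beta> (n + 1) * z ^ (n + 1)) sums g z"
    using g.series[OF z] g.low by (subst sums_zero_iff_shift) auto
  show "f z = z + p z + cnj (g z)"
    using z by (rule f_eq)
qed (intro holomorphic_intros p.holomorphic g.holomorphic)+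

lemma in_class_US_H: "f \<in> class_US_H"
proof -
  have "sense_preserving f"
    unfolding sense_preserving_def
  proof (intro exI conjI ballI)
    fix z
    assume z: "z \<in> unit_disk"
    have "deriv (\<lambda>z. z + p z) z = 1 + deriv p z"
      by (intro DERIV_imp_deriv derivative_intros p.has_field_derivative) (use z in auto)
    then show "(cmod (deriv (\<lambda>z. z + p z) z))\<^sup>2 - (cmod (deriv g z))\<^sup>2 > 0"
      using jacobian_pos z by simp
  qed (rule harmonic_rep_f)
  then show ?thesis
    unfolding class_US_H_def class_S_H_def class_H_def uniformly_starlike_def
    using harmonic_rep_f injective C1_on_f fully_starlike_f starlike_arc_f by blast
qed

end

section \<open>The averaged harmonic function\<close>

lemma averaged_series_sums:
  fixes k :: "complex \<Rightarrow> complex"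
  assumes "\<And>z. norm z < 1 \<Longrightarrow> (\<lambda>n. c n * z ^ n) sums k z" and "norm z < 1"
  shows "(\<lambda>n. (of_real a + of_nat n) / (of_real a + 1) * c n * z ^ n) sums
      ((of_real a * k z + z * deriv k z) / (of_real a + 1))"
proof -
  have "k holomorphic_on unit_disk"
    by (rule power_series_holomorphic[where a = c]) (use assms in auto)
  then have "(k has_field_derivative deriv k z) (at z)"
    using assms(2) by (simp add: holomorphic_derivI)
  from deriv_power_series_sums[OF assms this]
  have "(\<lambda>n. (of_real a * (c n * z ^ n) + z * (of_nat n * c n * z ^ (n - 1))) / (of_real a + 1)) sums
      ((of_real a * k z + z * deriv k z) / (of_real a + 1))"
    using assms by (intro sums_divide sums_add sums_mult) auto
  moreover have "(of_real a * (c n * z ^ n) + z * (of_nat n * c n * z ^ (n - 1))) / (of_real a + 1)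
      = (of_real a + of_nat n) / (of_real a + 1) * c n * z ^ n" for n
    by (cases n) (simp_all add: add_divide_distrib algebra_simps)
  ultimately show ?thesis
    by (simp only:)
qed

lemma averaging_factor_le:
  assumes "1 \<le> a" "1 \<le> n"
  shows "cmod ((of_real a + of_nat n) / (of_real a + 1)) \<le> real n"
proof -
  have "(a + real n) \<le> real n * (a + 1)"
    using mult_left_mono[of 1 "real n" a] assms by (simp add: algebra_simps)
  moreover have "(of_real a + of_nat n) / (of_real a + 1) = complex_of_real ((a + real n) / (a + 1))"
    by simp
  ultimately show ?thesis
    using assms by (simp only: norm_of_real) (simp add: field_simps)
qed

theorem theorem6:
  fixes F H G f h g :: "complex \<Rightarrow> complex"
    and A B :: "nat \<Rightarrow> complex"
    and a :: real
  assumes "harmonic_rep F H G A B"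
    and "deriv G 0 = 0" and "B 1 = 0"
    and "(\<lambda>n. real n * (2 * real n - 1) * (cmod (A n) + cmod (B n))) summable_on {2..}"
    and "(\<Sum>\<^sub>\<infinity>n\<in>{2..}. real n * (2 * real n - 1) * (cmod (A n) + cmod (B n))) \<le> 1"
    and "a \<ge> 1"
    and "\<And>z. z \<in> unit_disk \<Longrightarrow> h z = (of_real a * H z + z * deriv H z) / (of_real a + 1)"
    and "\<And>z. z \<in> unit_disk \<Longrightarrow> g z = (of_real a * G z + z * deriv G z) / (of_real a + 1)"
    and "\<And>z. z \<in> unit_disk \<Longrightarrow> f z = h z + cnj (g z)"
  shows "f \<in> class_US_H"
proof -
  note rep = assms(1)[unfolded harmonic_rep_def]
  define W where "W = (\<Sum>\<^sub>\<infinity>n\<in>{2..}. real n * (2 * real n - 1) * (cmod (A n) + cmod (B n)))"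
  \<comment> \<open>\<open>A\<close> and \<open>B\<close> are unconstrained at 0 and \<open>A\<close> also at 1; zeros there turn the given expansions
      of \<open>H z - z\<close> and \<open>G z\<close> into power series indexed from 0.\<close>
  define cut where "cut C n = (if n < 2 then 0 else C n)" for C :: "nat \<Rightarrow> complex" and n
  define avg where "avg C n = (of_real a + of_nat n) / (of_real a + 1) * cut C n"
    for C :: "nat \<Rightarrow> complex" and n
  have "((\<lambda>n. real n * (2 * real n - 1) * (cmod (A n) + cmod (B n))) has_sum W) {2..}"
    using assms(4) by (simp add: W_def has_sum_infsum)
  then have "((\<lambda>n. real n * (2 * real n - 1) * (cmod (cut A n) + cmod (cut B n))) has_sum W) UNIV"
    by (rule has_sum_cong_neutral[THEN iffD1, rotated -1]) (auto simp: cut_def)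
  then have W: "(\<lambda>n. real n * (2 * real n - 1) * (cmod (cut A n) + cmod (cut B n))) sums W"
    by (rule has_sum_imp_sums)
  have term_nonneg: "0 \<le> (2 * real n - 1) * cmod (avg C n)" for C n
    by (cases n) (auto simp: avg_def cut_def)
  have termle: "(2 * real n - 1) * cmod (avg C n) \<le> real n * (2 * real n - 1) * cmod (cut C n)" for C n
  proof (cases "n < 2")
    case False
    then have "cmod (avg C n) \<le> real n * cmod (cut C n)"
      unfolding avg_def norm_mult using assms(6)
      by (intro mult_right_mono averaging_factor_le) auto
    then have "(2 * real n - 1) * cmod (avg C n) \<le> (2 * real n - 1) * (real n * cmod (cut C n))"
      using False by (intro mult_left_mono) auto
    then show ?thesis
      by (simp add: mult_ac)
  qed (simp add: avg_def cut_def)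
  have sum_le: "(2 * real n - 1) * cmod (avg A n) + (2 * real n - 1) * cmod (avg B n)
      \<le> real n * (2 * real n - 1) * (cmod (cut A n) + cmod (cut B n))" for n
    using termle[of n A] termle[of n B] by (simp add: distrib_left)
  have "summable (\<lambda>n. (2 * real n - 1) * cmod (avg A n))"
    by (rule summable_comparison_test'[OF sums_summable[OF W], of 0])
      (use sum_le term_nonneg in \<open>smt (verit) real_norm_def\<close>)
  then obtain U where U: "(\<lambda>n. (2 * real n - 1) * cmod (avg A n)) sums U"
    by (auto simp: summable_def)
  have "summable (\<lambda>n. (2 * real n - 1) * cmod (avg B n))"
    by (rule summable_comparison_test'[OF sums_summable[OF W], of 0])
      (use sum_le term_nonneg in \<open>smt (verit) real_norm_def\<close>)
  then obtain V where V: "(\<lambda>n. (2 * real n - 1) * cmod (avg B n)) sums V"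
    by (auto simp: summable_def)
  have "U + V \<le> W"
    by (rule sums_le[OF sum_le sums_add[OF U V] W])
  then have UV: "U + V \<le> 1"
    using assms(5) by (simp add: W_def)
  have H: "(\<lambda>n. cut A n * z ^ n) sums (H z - z)" if "norm z < 1" for z
  proof -
    have "(\<lambda>n. cut A (n + 2) * z ^ (n + 2)) sums (H z - z)"
      using rep that by (simp add: cut_def)
    then show ?thesis
      by (subst (asm) sums_zero_iff_shift) (auto simp: cut_def)
  qed
  have G: "(\<lambda>n. cut B n * z ^ n) sums G z" if "norm z < 1" for z
  proof -
    have "cut B (n + 1) = B (n + 1)" for n
      using assms(3) by (cases n) (auto simp: cut_def)
    then have "(\<lambda>n. cut B (n + 1) * z ^ (n + 1)) sums G z"
      using rep that by simp
    then show ?thesis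
      by (subst (asm) sums_zero_iff_shift) (auto simp: cut_def)
  qed
  have H': "(\<lambda>n. avg A n * z ^ n) sums (h z - z)" if "norm z < 1" for z
  proof -
    have "(H has_field_derivative deriv H z) (at z)"
      by (rule holomorphic_derivI[of _ unit_disk]) (use rep that in auto)
    then have "((\<lambda>z. H z - z) has_field_derivative deriv H z - 1) (at z)"
      by (intro DERIV_diff DERIV_ident)
    then have d: "deriv (\<lambda>z. H z - z) z = deriv H z - 1"
      by (rule DERIV_imp_deriv)
    have "of_real a * (H z - z) + z * deriv (\<lambda>z. H z - z) z
        = (of_real a * H z + z * deriv H z) - z * (of_real a + 1)"
      unfolding d by (simp add: algebra_simps)
    moreover have "of_real (a + 1) \<noteq> (0 :: complex)"
      using assms(6) by (subst of_real_eq_0_iff) linarith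
    then have "of_real a + 1 \<noteq> (0 :: complex)"
      by (simp only: of_real_add of_real_1 not_False_eq_True)
    ultimately have "(of_real a * (H z - z) + z * deriv (\<lambda>z. H z - z) z) / (of_real a + 1) = h z - z"
      using assms(7)[of z] that
      by (simp only: diff_divide_distrib nonzero_mult_div_cancel_right mem_ball_0 not_False_eq_True)
    then show ?thesis
      using averaged_series_sums[OF H that, of a] by (simp add: avg_def)
  qed
  have G': "(\<lambda>n. avg B n * z ^ n) sums g z" if "norm z < 1" for z
    using averaged_series_sums[OF G that, of a] assms(8)[of z] that by (simp add: avg_def)
  interpret harmonic_perturbation "avg A" "\<lambda>z. h z - z" U "avg B" g V f
    by unfold_locales (use H' G' U V UV assms(9) in \<open>auto simp: avg_def cut_def\<close>)
  show ?thesis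
    by (rule in_class_US_H)
qed

end
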